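(* Let $q = p^n$, where $p$ is a prime number and $n \ge 2$ is an integer, and let $\mathbb{F}_q = \{c_0, c_1, \ldots, c_{q-1}\}$ be a fixed listing of the elements of the finite field with $q$ elements. For $\delta \in \{1,2\}$ define permutations of $\mathbb{F}_q$, as products of disjoint cycles, by $$a_0 := \prod_{j=0}^{p^{n-\delta}-1} (c_{jp^{\delta}}, c_{jp^{\delta}+1}, \ldots, c_{jp^{\delta}+p^{\delta}-1})$$ and, for $i \in \{1,2,\ldots,n-\delta\}$, $$a_i := \prod_{\substack{0\le j\le q-1\\ (j \bmod p^{i+\delta}) < p^{i+\delta-1}}} (c_{j}, c_{j+p^{i+\delta-1}}, \ldots, c_{j+(p-1)p^{i+\delta-1}}).$$ Then the set $$G = \{ a_0^{i_0} a_1^{i_1} \cdots a_{n-\delta}^{i_{n-\delta}} \mid 0 \leq i_0 \leq p^{\delta}-1,\ 0 \leq i_1, \ldots, i_{n-\delta} \leq p-1 \}$$ is an Abelian subgroup of order $q$ of the symmetric group $\mathfrak{S}_q$. Moreover, no permutation in $G$ other than the identity has a fixed point in $\mathbb{F}_q$.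
   Context: $\mathfrak{S}_q$ denotes the symmetric group on the set $\mathbb{F}_q$ of $q$ elements, and products are compositions of maps. The cycle $(x_1, x_2, \ldots, x_m)$ sends $x_1\mapsto x_2\mapsto\cdots\mapsto x_m\mapsto x_1$. For an integer $j\ge 0$ and $m\ge 1$, $j \bmod m$ denotes the residue of $j$ in $\{0,\ldots,m-1\}$. *)

theory Defs
  imports "HOL-Algebra.Coset" "HOL-Algebra.Bij" "HOL-Combinatorics.Cycles"
    "HOL-Library.Cardinality" "HOL-Computational_Algebra.Primes"
begin

definition comp_list :: "('a \<Rightarrow> 'a) list \<Rightarrow> 'a \<Rightarrow> 'a" where
  "comp_list fs = foldr (\<circ>) fs id"

text \<open>The permutations $a_0$ and, for $1 \le i \le n - \delta$, $a_i$. The cycles in each product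
  are composed in increasing order of $j$; for the intended $c$ (injective below $p^n$) they are
  disjoint, so the order is immaterial.
  \<^const>\<open>cycle_of_list\<close> applied to $[x_1, \ldots, x_m]$ sends $x_1$ to $x_2$, and so on, and
  $x_m$ to $x_1$.\<close>

definition gen_perm :: "nat \<Rightarrow> nat \<Rightarrow> nat \<Rightarrow> (nat \<Rightarrow> 'a) \<Rightarrow> nat \<Rightarrow> 'a \<Rightarrow> 'a" where
  "gen_perm p n \<delta> c i =
     (if i = 0 then
        comp_list [cycle_of_list [c (j * p ^ \<delta> + k). k \<leftarrow> [0..<p ^ \<delta>]].
                     j \<leftarrow> [0..<p ^ (n - \<delta>)]]
      else
        comp_list [cycle_of_list [c (j + k * p ^ (i + \<delta> - 1)). k \<leftarrow> [0..<p]].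
                     j \<leftarrow> [0..<p ^ n], j mod p ^ (i + \<delta>) < p ^ (i + \<delta> - 1)])"

definition perm_set :: "nat \<Rightarrow> nat \<Rightarrow> nat \<Rightarrow> (nat \<Rightarrow> 'a) \<Rightarrow> ('a \<Rightarrow> 'a) set" where
  "perm_set p n \<delta> c =
     {comp_list [gen_perm p n \<delta> c k ^^ e k. k \<leftarrow> [0..<Suc (n - \<delta>)]] | e :: nat \<Rightarrow> nat.
        e 0 \<le> p ^ \<delta> - 1 \<and> (\<forall>k\<in>{1..n - \<delta>}. e k \<le> p - 1)}"

end

theory Submission
  imports Defs
begin

text \<open>Identify each element \<open>c x\<close> with its index \<open>x < q\<close> and write \<open>x\<close> in mixed radix, the lowest
  digit having base \<open>p\<^sup>\<delta>\<close> and the others base \<open>p\<close>. Then \<open>a\<^sub>i\<close> increments the \<open>i\<close>-th digit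
  cyclically, so the \<open>a\<^sub>i\<close> commute and the products of their powers reach every index from \<open>0\<close>.
  An abelian transitive permutation group is regular: if \<open>g\<close> fixes \<open>x\<close>, then it fixes every
  \<open>h x\<close>, so \<open>g\<close> is the identity.\<close>

section \<open>Commuting transitive sets of maps\<close>

lemma mult_BijGroup_UNIV:
  "f \<in> Bij UNIV \<Longrightarrow> g \<in> Bij UNIV \<Longrightarrow> f \<otimes>\<^bsub>BijGroup UNIV\<^esub> g = f \<circ> g"
  by (auto simp: BijGroup_def compose_def)

lemma one_BijGroup_UNIV: "\<one>\<^bsub>BijGroup UNIV\<^esub> = id"
  by (auto simp: BijGroup_def)

text \<open>Bijectivity comes from the left inverse inside \<open>G\<close>, which commutativity
  makes two-sided. The order is found by evaluating at \<open>a\<close>, which maps \<open>G\<close>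
  bijectively onto the whole type.\<close>

lemma regular_abelian_perm_group:
  fixes G :: "('a \<Rightarrow> 'a) set"
  assumes id: "id \<in> G"
    and closed: "\<And>f g. f \<in> G \<Longrightarrow> g \<in> G \<Longrightarrow> f \<circ> g \<in> G"
    and comm: "\<And>f g. f \<in> G \<Longrightarrow> g \<in> G \<Longrightarrow> f \<circ> g = g \<circ> f"
    and inverse: "\<And>g. g \<in> G \<Longrightarrow> \<exists>h\<in>G. h \<circ> g = id"
    and trans: "\<And>y. \<exists>f\<in>G. f a = y"
  shows "subgroup G (BijGroup UNIV)"
    and "comm_group (BijGroup UNIV \<lparr>carrier := G\<rparr>)"
    and "order (BijGroup UNIV \<lparr>carrier := G\<rparr>) = CARD('a)"
    and "\<forall>g\<in>G. g \<noteq> id \<longrightarrow> (\<forall>x. g x \<noteq> x)"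
proof -
  interpret B: group "BijGroup (UNIV :: 'a set)"
    by (rule group_BijGroup)
  have free: "g = id" if "g \<in> G" "g x = x" for g x
  proof
    fix y
    \<comment> \<open>\<open>trans\<close> only gives maps starting from \<open>a\<close>, so
      \<open>x\<close> is first carried back to \<open>a\<close> and then on to
      \<open>y\<close>.\<close>
    obtain f f' where f: "f \<in> G" "f a = x" "f' \<in> G" "f' a = y"
      using trans by metis
    moreover obtain f_inv where "f_inv \<in> G" "f_inv \<circ> f = id"
      using inverse[OF f(1)] by blast
    ultimately have "f' \<circ> f_inv \<in> G" "(f' \<circ> f_inv) x = y"
      using closed by (auto simp: fun_eq_iff)
    then obtain h where h: "h \<in> G" "h x = y"
      by blast
    have "g (h x) = h (g x)"
      using comm[OF that(1) h(1)] by (metis comp_apply)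
    then show "g y = id y"
      using h that by simp
  qed
  then show "\<forall>g\<in>G. g \<noteq> id \<longrightarrow> (\<forall>x. g x \<noteq> x)"
    by blast
  have Bij: "g \<in> Bij UNIV" if g: "g \<in> G" for g
    using inverse[OF g] comm[OF g] by (auto simp: Bij_def intro: o_bij)
  show sub: "subgroup G (BijGroup UNIV)"
  proof (rule B.subgroupI)
    show "G \<subseteq> carrier (BijGroup UNIV)"
      using Bij by (auto simp: BijGroup_def)
    show "G \<noteq> {}"
      using id by blast
    show "f \<otimes>\<^bsub>BijGroup UNIV\<^esub> g \<in> G" if "f \<in> G" "g \<in> G" for f g
      using that by (simp add: mult_BijGroup_UNIV Bij closed)
    show "inv\<^bsub>BijGroup UNIV\<^esub> g \<in> G" if g: "g \<in> G" for g
    proof -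
      obtain h where h: "h \<in> G" "h \<circ> g = id"
        using inverse[OF g] by blast
      have "h \<otimes>\<^bsub>BijGroup UNIV\<^esub> g = \<one>\<^bsub>BijGroup UNIV\<^esub>"
        using h g by (simp add: mult_BijGroup_UNIV one_BijGroup_UNIV Bij)
      then have "inv\<^bsub>BijGroup UNIV\<^esub> g = h"
        using Bij[OF g] Bij[OF h(1)] by (intro B.inv_equality) (auto simp: BijGroup_def)
      then show ?thesis
        using h by simp
    qed
  qed
  show "comm_group (BijGroup UNIV \<lparr>carrier := G\<rparr>)"
    using B.subgroup_imp_group[OF sub]
    by (rule group.group_comm_groupI) (simp add: mult_BijGroup_UNIV Bij comm)
  have "bij_betw (\<lambda>g. g a) G UNIV"
  proof (rule bij_betw_imageI)
    show "inj_on (\<lambda>g. g a) G"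
    proof (rule inj_onI)
      fix f g assume f: "f \<in> G" and g: "g \<in> G" and eq: "f a = g a"
      obtain h where h: "h \<in> G" "h \<circ> g = id"
        using inverse[OF g] by blast
      have "(h \<circ> f) a = (h \<circ> g) a"
        using eq by simp
      \<comment> \<open>\<open>h\<close> undoes \<open>g\<close>, which agrees with \<open>f\<close>
        at \<open>a\<close>; so \<open>h \<circ> f\<close> fixes \<open>a\<close> and freeness
        applies.\<close>
      then have "h \<circ> f = id"
        using h by (intro free[OF closed[OF h(1) f]]) simp
      then have "g \<circ> (h \<circ> f) = g"
        by simp
      moreover have "g \<circ> h = id"
        using h comm[OF g h(1)] by simp
      ultimately show "f = g"
        by (simp add: o_assoc)
    qed
    show "(\<lambda>g. g a) ` G = UNIV"
      using trans by (metis (mono_tags, lifting) UNIV_eq_I imageI)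
  qed
  then show "order (BijGroup UNIV \<lparr>carrier := G\<rparr>) = CARD('a)"
    by (simp add: order_def bij_betw_same_card)
qed

section \<open>Products of commuting maps\<close>

lemma comp_list_Nil: "comp_list [] = id"
  by (simp add: comp_list_def)

lemma comp_list_Cons: "comp_list (f # fs) = f \<circ> comp_list fs"
  by (simp add: comp_list_def)

lemma comp_list_append: "comp_list (fs @ gs) = comp_list fs \<circ> comp_list gs"
  by (induction fs) (simp_all add: comp_list_Nil comp_list_Cons o_assoc)

lemma comp_list_commute:
  "(\<And>f. f \<in> set fs \<Longrightarrow> f \<circ> h = h \<circ> f) \<Longrightarrow> comp_list fs \<circ> h = h \<circ> comp_list fs"
proof (induction fs)
  case (Cons f fs)
  have "comp_list fs \<circ> h = h \<circ> comp_list fs" "f \<circ> h = h \<circ> f"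
    by (rule Cons.IH, rule Cons.prems, simp, rule Cons.prems, simp)
  then show ?case
    by (metis comp_list_Cons comp_assoc)
qed (simp add: comp_list_Nil)

lemma funpow_commute:
  fixes f g :: "'a \<Rightarrow> 'a"
  assumes "f \<circ> g = g \<circ> f"
  shows "(f ^^ a) \<circ> (g ^^ b) = (g ^^ b) \<circ> (f ^^ a)"
proof -
  have "(f ^^ a) \<circ> g = g \<circ> (f ^^ a)"
    using assms by (induction a) (auto simp: fun_eq_iff)
  then show ?thesis
    by (induction b) (auto simp: fun_eq_iff)
qed

text \<open>The number of factors is a parameter, for induction on it, and the exponents are
  unbounded, so that they can be added without reduction.\<close>

definition powers_prod :: "(nat \<Rightarrow> 'a \<Rightarrow> 'a) \<Rightarrow> nat \<Rightarrow> (nat \<Rightarrow> nat) \<Rightarrow> 'a \<Rightarrow> 'a" where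
  "powers_prod g N e = comp_list [g k ^^ e k. k \<leftarrow> [0..<N]]"

lemma powers_prod_0: "powers_prod g 0 e = id"
  by (simp add: powers_prod_def comp_list_Nil)

lemma powers_prod_Suc: "powers_prod g (Suc N) e = powers_prod g N e \<circ> (g N ^^ e N)"
  by (simp add: powers_prod_def comp_list_append comp_list_Cons comp_list_Nil)

lemma powers_prod_zero: "powers_prod g N (\<lambda>_. 0) = id"
  by (induction N) (simp_all add: powers_prod_0 powers_prod_Suc)

text \<open>Comparing powers instead of exponents allows exponents to be reduced modulo the period
  of a generator.\<close>

lemma powers_prod_cong:
  "(\<And>k. k < N \<Longrightarrow> g k ^^ e k = g k ^^ e' k) \<Longrightarrow> powers_prod g N e = powers_prod g N e'"
  by (induction N) (simp_all add: powers_prod_0 powers_prod_Suc)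

lemma powers_prod_commute:
  assumes "\<And>i k. i < k \<Longrightarrow> k \<le> N \<Longrightarrow> g i \<circ> g k = g k \<circ> g i"
  shows "powers_prod g N e \<circ> (g N ^^ b) = (g N ^^ b) \<circ> powers_prod g N e"
  unfolding powers_prod_def
  by (rule comp_list_commute) (auto intro!: funpow_commute assms)

text \<open>Addition of exponents becomes composition; closure, commutativity and inverses in
  \<open>G\<close> all follow from this.\<close>

lemma powers_prod_add:
  assumes "\<And>i k. i < k \<Longrightarrow> k < N \<Longrightarrow> g i \<circ> g k = g k \<circ> g i"
  shows "powers_prod g N e \<circ> powers_prod g N e' = powers_prod g N (\<lambda>k. e k + e' k)"
  using assms
proof (induction N)
  case (Suc N)
  have IH: "powers_prod g N e \<circ> powers_prod g N e' = powers_prod g N (\<lambda>k. e k + e' k)"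
    by (rule Suc.IH, rule Suc.prems) auto
  have "powers_prod g N e' \<circ> (g N ^^ e N) = (g N ^^ e N) \<circ> powers_prod g N e'"
    by (rule powers_prod_commute, rule Suc.prems) auto
  then have "powers_prod g (Suc N) e \<circ> powers_prod g (Suc N) e' =
      (powers_prod g N e \<circ> powers_prod g N e') \<circ> ((g N ^^ e N) \<circ> (g N ^^ e' N))"
    by (simp add: powers_prod_Suc fun_eq_iff)
  then show ?case
    by (simp only: IH powers_prod_Suc funpow_add)
qed (simp add: powers_prod_0)

section \<open>Cyclic increment of a digit\<close>

text \<open>With \<open>M = w * m\<close>, this increments modulo \<open>m\<close> the digit of weight \<open>w\<close>.\<close>

definition rot :: "nat \<Rightarrow> nat \<Rightarrow> nat \<Rightarrow> nat" where
  "rot M w x = M * (x div M) + (x mod M + w) mod M"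

lemma rot_div: "M > 0 \<Longrightarrow> rot M w x div M = x div M"
  by (simp add: rot_def)

lemma rot_funpow:
  assumes "M > 0"
  shows "(rot M w ^^ e) x = M * (x div M) + (x mod M + e * w) mod M"
proof (induction e)
  case (Suc e)
  have "(rot M w ^^ Suc e) x = rot M w (M * (x div M) + (x mod M + e * w) mod M)"
    using Suc by simp
  also have "\<dots> = M * (x div M) + ((x mod M + e * w) mod M + w) mod M"
    using assms by (simp add: rot_def)
  also have "((x mod M + e * w) mod M + w) mod M = (x mod M + Suc e * w) mod M"
    by (simp only: mod_add_left_eq) (simp add: ac_simps)
  finally show ?case .
qed simp

text \<open>\<open>rot\<close> stays within a block of \<open>M\<close> consecutive numbers, and
  \<open>{..<q}\<close> is a union of such blocks.\<close>

lemma rot_less: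
  assumes "M dvd q" "x < q"
  shows "rot M w x < q"
proof -
  obtain t where t: "q = M * t"
    using assms by blast
  with assms have M: "M > 0"
    by (cases "M = 0") auto
  have "x div M < t"
    using assms t by (metis less_mult_imp_div_less mult.commute)
  then have "rot M w x div M < t"
    using M by (simp add: rot_div)
  then show ?thesis
    using M t by (simp add: div_less_iff_less_mult mult.commute)
qed

text \<open>Modulus and increment are multiples of \<open>N\<close>, so the part \<open>r\<close>
  below \<open>N\<close> neither changes nor causes a carry.\<close>

lemma rot_shift:
  assumes "r < N"
  shows "rot (N * u) (N * v) (N * z + r) = N * rot u v z + r"
proof -
  have *: "(N * y + r) mod (N * u) = N * (y mod u) + r"
    "(N * y + r) div (N * u) = y div u" for y
    using assms by (simp_all add: mod_mult2_eq div_mult2_eq)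
  have "((N * z + r) mod (N * u) + N * v) mod (N * u) = (N * (z mod u + v) + r) mod (N * u)"
    by (subst *(1)) (simp only: distrib_left ac_simps)
  also have "\<dots> = N * ((z mod u + v) mod u) + r"
    by (simp only: *)
  finally have mod: "((N * z + r) mod (N * u) + N * v) mod (N * u) = N * ((z mod u + v) mod u) + r" .
  show ?thesis
    unfolding rot_def mod *(2) by (simp add: algebra_simps)
qed

text \<open>The left-hand outer map changes only the remainder modulo \<open>N\<close>, the inner
  one only the quotient by \<open>N\<close>.\<close>

lemma rot_commute:
  assumes "N > 0" "N dvd w" "N dvd M"
  shows "rot N v (rot M w x) = rot M w (rot N v x)"
proof -
  obtain a b where ab: "w = N * a" "M = N * b"
    using assms by (metis dvdE)
  define z r where "z = x div N" and "r = x mod N"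
  have x: "x = N * z + r" and r: "r < N"
    using assms by (simp_all add: z_def r_def)
  have N: "rot N v (N * y + r) = N * y + (r + v) mod N" for y
    using r by (simp add: rot_def)
  have "(r + v) mod N < N"
    using assms by simp
  then show ?thesis
    by (simp add: ab x N rot_shift[OF r] rot_shift)
qed

section \<open>Products of disjoint cycles\<close>

lemma cycle_of_list_nth:
  assumes "distinct xs" "k < length xs"
  shows "cycle_of_list xs (xs ! k) = xs ! (Suc k mod length xs)"
proof -
  have "map (cycle_of_list xs) xs = rotate 1 xs"
    using cyclic_rotation[OF assms(1), of 1] by simp
  then have "map (cycle_of_list xs) xs ! k = rotate 1 xs ! k"
    by simp
  then show ?thesis
    using assms by (simp add: nth_rotate1)
qed

text \<open>The label \<open>b x\<close> names the only factor that can move \<open>x\<close>. Since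
  \<open>T\<close> keeps the label, the factors applied afterwards leave \<open>T x\<close>
  alone.\<close>

lemma comp_list_disjoint:
  assumes "distinct js"
    and "\<And>j x. j \<in> set js \<Longrightarrow> P x \<Longrightarrow> f j x = (if b x = j then T x else x)"
    and "\<And>x. P x \<Longrightarrow> P (T x) \<and> b (T x) = b x"
    and "P x"
  shows "comp_list (map f js) x = (if b x \<in> set js then T x else x)"
  using assms(1,2)
proof (induction js)
  case (Cons j js)
  then have IH: "comp_list (map f js) x = (if b x \<in> set js then T x else x)"
    by simp
  show ?case
    using Cons.prems assms(3,4) by (auto simp: comp_list_Cons IH)
qed (simp add: comp_list_Nil)

text \<open>This covers both kinds of generator. Clearing the digit of weight \<open>w\<close> in an
  index gives the start of its cycle, and the digit itself is the position there, so a step along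
  the cycle increments that digit.\<close>

lemma comp_list_cycles:
  assumes inj: "inj_on c {..<q}" and q: "w * m dvd q" and "w > 0" "m > 0"
    and bs: "distinct bs" "\<And>b. b \<in> set bs \<longleftrightarrow> b < q \<and> b mod (w * m) < w"
    and x: "x < q"
  shows "comp_list [cycle_of_list [c (b + k * w). k \<leftarrow> [0..<m]]. b \<leftarrow> bs] (c x) = c (rot (w * m) w x)"
proof -
  define M where "M = w * m"
  have M: "M > 0"
    using assms by (simp add: M_def)
  \<comment> \<open>\<open>c y\<close> lies on the cycle starting at \<open>c (base y)\<close>, in position \<open>digit y\<close>.\<close>
  define base where "base y = M * (y div M) + y mod w" for y
  define digit where "digit y = y mod M div w" for y
  have split: "y = base y + digit y * w" for y
  proof -
    have "y mod M = digit y * w + y mod w"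
      using mod_mult2_eq[of y w m] \<open>w > 0\<close>
      by (simp add: M_def digit_def)
    then show ?thesis
      by (metis base_def add.assoc add.commute mult_div_mod_eq)
  qed
  have digit: "digit y < m" for y
    using M by (simp add: digit_def M_def div_less_iff_less_mult mult.commute \<open>w > 0\<close>)
  \<comment> \<open>The start \<open>b\<close> has digit zero at weight \<open>w\<close>, so adding
    \<open>k * w\<close> causes no carry. Hence cycles with different starts are disjoint.\<close>
  have unique: "base (b + k * w) = b \<and> digit (b + k * w) = k"
    if b: "b mod M < w" and k: "k < m" for b k
  proof -
    have "b mod M + k * w < Suc k * w"
      using b by simp
    also have "\<dots> \<le> M"
      unfolding M_def using k by (metis Suc_leI mult.commute mult_le_mono2)
    finally have less: "b mod M + k * w < M" .
    have eq: "b + k * w = (b mod M + k * w) + M * (b div M)"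
      by (metis add.assoc add.commute mod_mult_div_eq)
    have 1: "(b + k * w) div M = b div M"
      unfolding eq using div_mult_self2[of M "b mod M + k * w" "b div M"] M
      by (simp only: div_less[OF less] add_0_right)
    have 2: "(b + k * w) mod M = b mod M + k * w"
      unfolding eq by (simp only: mod_mult_self2 mod_less[OF less])
    have "b mod w = b mod M mod w"
      by (simp add: M_def mod_mod_cancel)
    then show ?thesis
      using b by (simp add: base_def digit_def 1 2)
  qed
  have base_mod: "base y mod M < w" for y
  proof -
    have "y mod w < w" "w \<le> M"
      using assms by (simp_all add: M_def)
    then show ?thesis
      by (simp add: base_def)
  qed
  have rot: "rot M w y = base y + (Suc (digit y) mod m) * w" for y
  proof -
    have d: "(y mod M + w) div w = Suc (digit y)" "(y mod M + w) mod w = y mod w"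
      using \<open>w > 0\<close> div_add_self2[of w "y mod M"] by (simp_all add: digit_def M_def mod_mod_cancel)
    have "(y mod M + w) mod M = (Suc (digit y) mod m) * w + y mod w"
      using mod_mult2_eq[of "y mod M + w" w m] by (simp add: M_def[symmetric] d del: mod_add_self2)
    then show ?thesis
      by (simp add: rot_def base_def)
  qed
  have base_rot: "base (rot M w y) = base y" for y
    using unique[OF base_mod, of "Suc (digit y) mod m" y] \<open>m > 0\<close> by (simp add: rot)
  have base_less: "base y < q" if "y < q" for y
    using split[of y] that by linarith
  \<comment> \<open>The whole cycle lies in the block of length \<open>M\<close> containing
    \<open>b\<close>, and \<open>M\<close> divides \<open>q\<close>.\<close>
  have less: "b + k * w < q" if b: "b < q" "b mod M < w" and k: "k < m" for b k
  proof -
    have "(b + k * w) div M = b div M"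
    proof -
      have "b div M = base (b + k * w) div M"
        using unique[OF b(2) k] by simp
      also have "\<dots> = (b + k * w) div M"
      proof -
        have "(b + k * w) mod w < w" "w \<le> M"
          using assms by (simp_all add: M_def)
        then have "(b + k * w) mod w < M"
          by (rule less_le_trans)
        then show ?thesis
          using M by (simp add: base_def)
      qed
      finally show ?thesis ..
    qed
    moreover obtain t where t: "q = M * t"
      using q by (auto simp: M_def)
    ultimately show ?thesis
      using b M by (metis div_less_iff_less_mult mult.commute)
  qed
  have cycle: "cycle_of_list [c (b + k * w). k \<leftarrow> [0..<m]] (c y) =
      c (if base y = b then rot M w y else y)" if b: "b \<in> set bs" and y: "y < q" for b y
  proof -
    let ?xs = "[c (b + k * w). k \<leftarrow> [0..<m]]"
    have b': "b < q" "b mod M < w"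
      using b bs by (auto simp: M_def)
    have "inj_on (\<lambda>k. c (b + k * w)) {..<m}"
    proof (rule inj_onI)
      fix k l assume "k \<in> {..<m}" "l \<in> {..<m}" "c (b + k * w) = c (b + l * w)"
      then have "b + k * w = b + l * w"
        by (intro inj_onD[OF inj]) (simp_all add: less[OF b'])
      then show "k = l"
        using \<open>w > 0\<close> by simp
    qed
    then have dist: "distinct ?xs"
      by (simp add: distinct_map atLeast0LessThan)
    show ?thesis
    proof (cases "base y = b")
      case True
      then have "c (b + digit y * w) = c y"
        using split[of y] by metis
      then have "c y = ?xs ! digit y"
        using digit[of y] by simp
      then have "cycle_of_list ?xs (c y) = ?xs ! (Suc (digit y) mod m)"
        using cycle_of_list_nth[OF dist] digit[of y] by simp
      then show ?thesis
        using True \<open>m > 0\<close> by (simp add: rot)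
    next
      case False
      have "c y \<notin> set ?xs"
      proof
        assume "c y \<in> set ?xs"
        then obtain k where k: "k < m" "c y = c (b + k * w)"
          by auto
        then have "y = b + k * w"
          by (intro inj_onD[OF inj]) (simp_all add: less[OF b'] y)
        then show False
          using unique[OF b'(2) k(1)] False by simp
      qed
      then show ?thesis
        using False by (simp add: id_outside_supp)
    qed
  qed
  \<comment> \<open>\<open>comp_list_disjoint\<close> is applied to values of \<open>c\<close>, so
    labels and increments are transported from the indices along \<open>c\<close>.\<close>
  define c' where "c' = inv_into {..<q} c"
  have c': "c' (c y) = y" if "y < q" for y
    using inj that by (simp add: c'_def inv_into_f_f)
  have rot_q: "rot M w y < q" if "y < q" for y
    using rot_less q that by (simp add: M_def)
  have "comp_list [cycle_of_list [c (b + k * w). k \<leftarrow> [0..<m]]. b \<leftarrow> bs] (c x) =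
      (if base (c' (c x)) \<in> set bs then c (rot M w (c' (c x))) else c x)"
  proof (rule comp_list_disjoint[where P = "\<lambda>y. y \<in> c ` {..<q}" and b = "\<lambda>y. base (c' y)"
        and T = "\<lambda>y. c (rot M w (c' y))"])
    show "cycle_of_list [c (b + k * w). k \<leftarrow> [0..<m]] z = (if base (c' z) = b then c (rot M w (c' z)) else z)"
      if "b \<in> set bs" "z \<in> c ` {..<q}" for b z
    proof -
      obtain y where y: "y < q" "z = c y"
        using \<open>z \<in> c ` {..<q}\<close> by blast
      show ?thesis
        unfolding y(2) cycle[OF \<open>b \<in> set bs\<close> y(1)] c'[OF y(1)] by simp
    qed
  qed (use x in \<open>auto simp: bs(1) c' rot_q base_rot\<close>)
  \<comment> \<open>\<open>base x\<close> is always one of the starts in \<open>bs\<close>, so the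
    branch fixing \<open>c x\<close> does not occur.\<close>
  then show ?thesis
    using x base_less base_mod bs(2) by (simp add: c' M_def)
qed

section \<open>The generators\<close>

text \<open>The weight of digit \<open>i\<close> in the mixed radix system with bases \<open>p\<^sup>\<delta>, p, p, \<dots>\<close>\<close>

definition weight :: "nat \<Rightarrow> nat \<Rightarrow> nat \<Rightarrow> nat" where
  "weight p \<delta> i = (if i = 0 then 1 else p ^ (i + \<delta> - 1))"

definition radix :: "nat \<Rightarrow> nat \<Rightarrow> nat \<Rightarrow> nat" where
  "radix p \<delta> i = (if i = 0 then p ^ \<delta> else p)"

lemma weight_pos: "p > 0 \<Longrightarrow> weight p \<delta> i > 0"
  by (simp add: weight_def)

lemma radix_pos: "p > 0 \<Longrightarrow> radix p \<delta> i > 0"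
  by (simp add: radix_def)

text \<open>The modulus at digit \<open>i\<close> is the weight of the next digit; hence the
  generators appear as \<open>rot\<close> with two successive weights.\<close>

lemma weight_mult_radix: "\<delta> > 0 \<Longrightarrow> weight p \<delta> i * radix p \<delta> i = weight p \<delta> (Suc i)"
  by (cases i) (auto simp: weight_def radix_def simp flip: power_Suc2)

lemma weight_dvd: "i \<le> k \<Longrightarrow> weight p \<delta> i dvd weight p \<delta> k"
  by (auto simp: weight_def intro: le_imp_power_dvd)

lemma gen_perm_apply:
  assumes "p > 0" "\<delta> > 0" "i \<le> n - \<delta>" "\<delta> \<le> n" and inj: "inj_on c {..<p ^ n}" and x: "x < p ^ n"
  shows "gen_perm p n \<delta> c i (c x) = c (rot (weight p \<delta> (Suc i)) (weight p \<delta> i) x)"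
proof (cases "i = 0")
  case True
  let ?M = "p ^ \<delta>"
  \<comment> \<open>The multiples of \<open>?M\<close> are the numbers with
    \<open>b mod ?M < 1\<close>, which is the condition on starts for weight
    \<open>1\<close>.\<close>
  let ?bs = "map (\<lambda>j. j * ?M) [0..<p ^ (n - \<delta>)]"
  have pn: "p ^ n = p ^ (n - \<delta>) * ?M"
    using assms by (simp flip: power_add)
  have "comp_list [cycle_of_list [c (b + k * 1). k \<leftarrow> [0..<?M]]. b \<leftarrow> ?bs] (c x) = c (rot (1 * ?M) 1 x)"
  proof (rule comp_list_cycles[OF inj])
    show "distinct ?bs"
      using assms by (simp add: distinct_map inj_on_def)
    show "b \<in> set ?bs \<longleftrightarrow> b < p ^ n \<and> b mod (1 * ?M) < 1" for b
      using assms by (auto simp: pn)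
  qed (use assms x in \<open>auto simp: le_imp_power_dvd\<close>)
  then show ?thesis
    using True by (simp add: gen_perm_def weight_def comp_def)
next
  case False
  let ?w = "p ^ (i + \<delta> - 1)"
  let ?bs = "filter (\<lambda>j. j mod p ^ (i + \<delta>) < ?w) [0..<p ^ n]"
  have wp: "?w * p = p ^ (i + \<delta>)"
    using False by (simp flip: power_Suc2)
  have "comp_list [cycle_of_list [c (b + k * ?w). k \<leftarrow> [0..<p]]. b \<leftarrow> ?bs] (c x) = c (rot (?w * p) ?w x)"
    by (rule comp_list_cycles[OF inj])
      (unfold wp, use assms x in \<open>auto intro: le_imp_power_dvd\<close>)
  moreover have "gen_perm p n \<delta> c i =
      comp_list [cycle_of_list [c (b + k * ?w). k \<leftarrow> [0..<p]]. b \<leftarrow> ?bs]"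
  proof -
    \<comment> \<open>The guarded list comprehension unfolds to this \<open>concat\<close>, whereas
      \<open>comp_list_cycles\<close> expects a map over a list of starts.\<close>
    have "concat (map (\<lambda>x. if P x then [h x] else []) xs) = map h (filter P xs)"
      for P xs and h :: "nat \<Rightarrow> 'a \<Rightarrow> 'a"
      by (induction xs) simp_all
    then show ?thesis
      using False by (simp add: gen_perm_def)
  qed
  ultimately show ?thesis
    using False by (simp add: wp[unfolded One_nat_def] weight_def)
qed

section \<open>The group of products of powers of the generators\<close>

theorem theorem3p1:
  fixes p n q \<delta> :: nat
    and c :: "nat \<Rightarrow> 'a :: {field, finite}"
  assumes "prime p" and "n \<ge> 2" and "q = p ^ n"
    and "CARD('a) = q"
    and "bij_betw c {0..<q} (UNIV :: 'a set)"
    and "\<delta> \<in> {1, 2}"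
  defines "G \<equiv> perm_set p n \<delta> c"
  shows "subgroup G (BijGroup (UNIV :: 'a set)) \<and>
         comm_group (BijGroup (UNIV :: 'a set) \<lparr>carrier := G\<rparr>) \<and>
         order (BijGroup (UNIV :: 'a set) \<lparr>carrier := G\<rparr>) = q \<and>
         (\<forall>g\<in>G. g \<noteq> id \<longrightarrow> (\<forall>x. g x \<noteq> x))"
proof -
  define N where "N = Suc (n - \<delta>)"
  define g where "g = gen_perm p n \<delta> c"
  let ?w = "weight p \<delta>" and ?m = "radix p \<delta>"
  have p: "p > 0" and \<delta>: "\<delta> > 0" "\<delta> \<le> n"
    using assms by (auto simp: prime_gt_0_nat)
  have inj: "inj_on c {..<p ^ n}" and surj: "\<And>y. \<exists>x<q. y = c x"
    using assms by (auto simp: bij_betw_def atLeast0LessThan)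
  \<comment> \<open>The weight one past the last digit has exponent
    \<open>N + \<delta> - 1 = n\<close>.\<close>
  have q: "?w N = q"
    using \<delta> \<open>q = p ^ n\<close> by (simp add: weight_def N_def)
  have g: "g i (c x) = c (rot (?w (Suc i)) (?w i) x)" if "i < N" "x < q" for i x
    using that p \<delta> inj \<open>q = p ^ n\<close> by (simp add: g_def N_def gen_perm_apply)
  have rot_q: "rot (?w (Suc i)) (?w i) x < q" if "i < N" "x < q" for i x
    using that q by (metis Suc_leI rot_less weight_dvd)
  have g_comm: "g i \<circ> g k = g k \<circ> g i" if ik: "i < k" "k < N" for i k
  proof
    fix y
    obtain x where x: "x < q" "y = c x"
      using surj by blast
    \<comment> \<open>For \<open>i < k\<close> the modulus \<open>?w (Suc i)\<close> divides both
      \<open>?w k\<close> and \<open>?w (Suc k)\<close>.\<close>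
    have "rot (?w (Suc i)) (?w i) (rot (?w (Suc k)) (?w k) x) =
        rot (?w (Suc k)) (?w k) (rot (?w (Suc i)) (?w i) x)"
      using ik p by (intro rot_commute weight_dvd weight_pos) auto
    then show "(g i \<circ> g k) y = (g k \<circ> g i) y"
      using ik x by (simp add: g rot_q)
  qed
  have g_pow: "(g i ^^ e) (c x) = c ((rot (?w (Suc i)) (?w i) ^^ e) x) \<and>
      (rot (?w (Suc i)) (?w i) ^^ e) x < q" if "i < N" "x < q" for i x e
    using that by (induction e) (simp_all add: g rot_q)
  \<comment> \<open>\<open>?m i\<close> increments of size \<open>?w i\<close> add up to the modulus
    \<open>?w (Suc i)\<close>.\<close>
  have g_order: "g i ^^ ?m i = id" if i: "i < N" for i
  proof
    fix y
    obtain x where x: "x < q" "y = c x"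
      using surj by blast
    show "(g i ^^ ?m i) y = id y"
      using g_pow[OF i x(1)] x weight_pos[OF p, of \<delta> "Suc i"] weight_mult_radix[OF \<delta>(1), of p i]
      by (simp add: rot_funpow mult.commute)
  qed
  have g_mod: "g i ^^ (e mod ?m i) = g i ^^ e" if "i < N" for i e
    using g_order[OF that] by (simp add: funpow_mod_eq fun_eq_iff)
  have small: "(e 0 \<le> p ^ \<delta> - 1 \<and> (\<forall>k\<in>{1..n - \<delta>}. e k \<le> p - 1)) \<longleftrightarrow> (\<forall>k<N. e k < ?m k)" for e
  proof -
    have "e 0 \<le> p ^ \<delta> - 1 \<longleftrightarrow> e 0 < p ^ \<delta>" "\<And>k. e k \<le> p - 1 \<longleftrightarrow> e k < p"
      using p by (simp_all add: Suc_le_eq[symmetric] le_diff_conv2 Suc_leI)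
    then show ?thesis
      by (auto simp: radix_def N_def less_Suc_eq_le)
  qed
  have "G = {powers_prod g N e | e. \<forall>k<N. e k < ?m k}"
    by (simp only: G_def perm_set_def small powers_prod_def g_def N_def)
  also have "\<dots> = range (powers_prod g N)"
  proof -
    have "powers_prod g N e = powers_prod g N (\<lambda>k. e k mod ?m k)" for e
      by (rule powers_prod_cong) (simp add: g_mod)
    moreover have "e k mod ?m k < ?m k" for e :: "nat \<Rightarrow> nat" and k
      using radix_pos[OF p] by simp
    ultimately show ?thesis
      by blast
  qed
  finally have G: "G = range (powers_prod g N)" .
  \<comment> \<open>The exponents are the digits of \<open>x\<close>, set one at a time; numbers
    below \<open>?w k\<close> have only the first \<open>k\<close> digits.\<close>
  have reach: "\<exists>e. powers_prod g k e (c 0) = c x" if "k \<le> N" "x < ?w k" for k x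
    using that
  proof (induction k arbitrary: x)
    case 0
    then show ?case
      by (auto simp: powers_prod_0 weight_def)
  next
    case (Suc k)
    define d r where "d = x div ?w k" and "r = x mod ?w k"
    have r: "r < ?w k" and x: "x = r + d * ?w k"
      using weight_pos[OF p] by (simp_all add: d_def r_def)
    obtain e where e: "powers_prod g k e (c 0) = c r"
      using Suc r by auto
    have "?w k \<le> q" "?w k \<le> ?w (Suc k)"
      using Suc.prems q weight_dvd[of k N p \<delta>] weight_dvd[of k "Suc k" p \<delta>] weight_pos[OF p]
      by (metis Suc_leD dvd_imp_le, metis dvd_imp_le lessI less_imp_le)
    \<comment> \<open>The digit does not wrap around, since \<open>r + d * ?w k = x\<close> is below
      the modulus \<open>?w (Suc k)\<close>.\<close>
    then have "(g k ^^ d) (c r) = c x"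
      using g_pow[of k r d] Suc.prems r x weight_pos[OF p, of \<delta> "Suc k"] by (simp add: rot_funpow)
    \<comment> \<open>In \<open>powers_prod\<close> the factor of highest index acts first, but here
      it has to act after the lower digits are set.\<close>
    moreover have "powers_prod g k e' \<circ> (g k ^^ d) = (g k ^^ d) \<circ> powers_prod g k e'" for e'
      using Suc.prems by (intro powers_prod_commute g_comm) auto
    moreover have "powers_prod g k (e(k := d)) = powers_prod g k e"
      by (rule powers_prod_cong) simp
    ultimately have "powers_prod g (Suc k) (e(k := d)) (c 0) = c x"
      using e by (simp add: powers_prod_Suc fun_eq_iff)
    then show ?case
      by blast
  qed
  have id: "id \<in> G"
    using G powers_prod_zero by (metis rangeI)
  have closed: "f \<circ> h \<in> G" and comm: "f \<circ> h = h \<circ> f" if "f \<in> G" "h \<in> G" for f h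
    using that G powers_prod_add[OF g_comm] by (auto simp: add.commute)
  have from_0: "\<exists>f\<in>G. f (c 0) = y" for y
    using reach[of N] surj[of y] by (auto simp: q G)
  have inverse: "\<exists>h\<in>G. h \<circ> f = id" if f: "f \<in> G" for f
  proof -
    obtain e where e: "f = powers_prod g N e"
      using f unfolding G by blast
    \<comment> \<open>Exponents are natural numbers, so \<open>(?m k - 1) * e k\<close> serves as
      \<open>- e k\<close> modulo \<open>?m k\<close>.\<close>
    have "powers_prod g N (\<lambda>k. (?m k - 1) * e k) \<circ> f = powers_prod g N (\<lambda>k. (?m k - 1) * e k + e k)"
      unfolding e by (intro powers_prod_add g_comm)
    also have "(\<lambda>k. (?m k - 1) * e k + e k) = (\<lambda>k. ?m k * e k)"
    proof
      show "(?m k - 1) * e k + e k = ?m k * e k" for k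
        using radix_pos[OF p, of \<delta> k] by (cases "?m k") simp_all
    qed
    also have "powers_prod g N (\<lambda>k. ?m k * e k) = powers_prod g N (\<lambda>_. 0)"
      by (rule powers_prod_cong) (simp add: funpow_mult[symmetric] g_order)
    finally show ?thesis
      using G powers_prod_zero by (metis rangeI)
  qed
  show ?thesis
    using regular_abelian_perm_group[OF id closed comm inverse from_0] \<open>CARD('a) = q\<close> by blast
qed

end
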